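(* Let $G$ be a graph of local boxicity at most $2$ and let $r=\omega(G)$ be its clique number. Then $\chi(G)\le 320\cdot r^3\log(2r)$.
   Context: All graphs are finite and simple; $\log$ is the binary logarithm; $\chi$ is the chromatic number and $\omega$ the clique number. A real interval is either a bounded interval of $\mathbb{R}$ or $\mathbb{R}$ itself. For an integer $d'\ge 1$, a $d'$-box is a Cartesian product $I_1\times\cdots\times I_{d'}$ of real intervals; it is local in dimension $i$ if $I_i$ is bounded. A $d$-local box in dimension $d'\ge d$ is a $d'$-box that is local in at most $d$ dimensions. The local boxicity $\mathrm{lbox}(G)$ of a graph $G$ is the minimum integer $d$ such that, for some $d'$, there are $d$-local boxes $(B_v)_{v\in V(G)}$ in dimension $d'$ such that two distinct vertices $u,v$ are adjacent in $G$ if and only if $B_u\cap B_v\neq\emptyset$. *)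

theory Defs
  imports "HOL-Analysis.Analysis" "Graph_Theory.Pair_Digraph"
begin

text \<open>A finite simple graph is a \<^term>\<open>G :: 'a pair_pre_digraph\<close> with \<^prop>\<open>pair_graph G\<close>, that is,
  a finite, loop-free, symmetric digraph; an edge between \<open>u\<close> and \<open>v\<close> is the pair of arcs
  \<open>(u, v)\<close> and \<open>(v, u)\<close>.\<close>

definition clique :: "'a pair_pre_digraph \<Rightarrow> 'a set \<Rightarrow> bool" where
  "clique G C \<longleftrightarrow> C \<subseteq> pverts G \<and> (\<forall>u\<in>C. \<forall>v\<in>C. u \<noteq> v \<longrightarrow> (u, v) \<in> parcs G)"

definition clique_number :: "'a pair_pre_digraph \<Rightarrow> nat" where
  "clique_number G = Max {card C | C. clique G C}"

definition proper_colouring :: "'a pair_pre_digraph \<Rightarrow> nat \<Rightarrow> ('a \<Rightarrow> nat) \<Rightarrow> bool" where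
  "proper_colouring G k c \<longleftrightarrow>
     (\<forall>v\<in>pverts G. c v < k) \<and> (\<forall>(u, v)\<in>parcs G. c u \<noteq> c v)"

definition chromatic_number :: "'a pair_pre_digraph \<Rightarrow> nat" where
  "chromatic_number G = (LEAST k. \<exists>c. proper_colouring G k c)"

text \<open>Intervals may be open, closed, half-open or a single point, but not empty.\<close>

definition real_interval :: "real set \<Rightarrow> bool" where
  "real_interval I \<longleftrightarrow> is_interval I \<and> I \<noteq> {} \<and> (bounded I \<or> I = UNIV)"

text \<open>A \<open>d\<close>-local box in dimension \<open>d'\<close>. Points of the \<open>d'\<close>-dimensional space are the extensional
  functions on \<open>{..<d'}\<close>. As the factors are nonempty, the box \<open>B\<close> determines them, and hence
  also the dimensions in which it is local.\<close>

definition local_box :: "nat \<Rightarrow> nat \<Rightarrow> (nat \<Rightarrow> real) set \<Rightarrow> bool" where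
  "local_box d d' B \<longleftrightarrow> 1 \<le> d' \<and> d \<le> d' \<and>
     (\<exists>I. (\<forall>i<d'. real_interval (I i)) \<and> B = Pi\<^sub>E {..<d'} I \<and>
          card {i. i < d' \<and> bounded (I i)} \<le> d)"

definition local_box_representation ::
    "'a pair_pre_digraph \<Rightarrow> nat \<Rightarrow> nat \<Rightarrow> ('a \<Rightarrow> (nat \<Rightarrow> real) set) \<Rightarrow> bool" where
  "local_box_representation G d d' B \<longleftrightarrow>
     (\<forall>v\<in>pverts G. local_box d d' (B v)) \<and>
     (\<forall>u\<in>pverts G. \<forall>v\<in>pverts G. u \<noteq> v \<longrightarrow> ((u, v) \<in> parcs G \<longleftrightarrow> B u \<inter> B v \<noteq> {}))"

definition local_boxicity :: "'a pair_pre_digraph \<Rightarrow> nat" where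
  "local_boxicity G = (LEAST d. \<exists>d' B. local_box_representation G d d' B)"

text \<open>The three extrema above are attained on finite simple graphs.\<close>

lemma clique_number_attained:
  assumes "pair_graph G"
  shows "\<exists>C. clique G C \<and> card C = clique_number G"
    and "clique G C \<Longrightarrow> card C \<le> clique_number G"
proof -
  interpret pair_graph G by fact
  have eq: "{card C | C. clique G C} = card ` {C. clique G C}"
    by auto
  have "{C. clique G C} \<subseteq> Pow (pverts G)"
    by (auto simp: clique_def)
  then have fin: "finite {card C | C. clique G C}"
    unfolding eq by (meson finite_Pow_iff finite_imageI finite_subset pair_finite_verts)
  have "clique G {}"
    by (simp add: clique_def)
  then have "{card C | C. clique G C} \<noteq> {}"
    by blast
  from Max_in[OF fin this] show "\<exists>C. clique G C \<and> card C = clique_number G"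
    unfolding clique_number_def by fastforce
  show "card C \<le> clique_number G" if "clique G C"
    unfolding clique_number_def using fin that by (intro Max_ge) auto
qed

lemma chromatic_number_attained:
  assumes "pair_graph G"
  shows "\<exists>c. proper_colouring G (chromatic_number G) c"
proof -
  interpret pair_graph G by fact
  obtain c where c: "bij_betw c (pverts G) {0..<card (pverts G)}"
    using ex_bij_betw_finite_nat[OF pair_finite_verts] by blast
  have "c u \<noteq> c v" if "(u, v) \<in> parcs G" for u v
    using that c in_arcsD1[OF that] in_arcsD2[OF that] pair_no_loops[OF that]
    by (auto simp: bij_betw_def dest: inj_onD)
  moreover have "c v < card (pverts G)" if "v \<in> pverts G" for v
    using c that by (auto simp: bij_betw_def)
  ultimately have "proper_colouring G (card (pverts G)) c"
    by (auto simp: proper_colouring_def)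
  then show ?thesis
    unfolding chromatic_number_def
    by (rule_tac LeastI[where P = "\<lambda>k. \<exists>c. proper_colouring G k c"]) blast
qed

lemma local_boxicity_attained:
  assumes "pair_graph G"
  shows "\<exists>d' B. local_box_representation G (local_boxicity G) d' B"
proof -
  interpret pair_graph G by fact
  define n where "n = card (pverts G)"
  obtain c where c: "bij_betw c (pverts G) {0..<n}"
    using ex_bij_betw_finite_nat[OF pair_finite_verts] n_def by blast
  define w where "w = the_inv_into (pverts G) c"
  have wc: "w (c v) = v" if "v \<in> pverts G" for v
    using c that by (simp add: w_def bij_betw_def the_inv_into_f_f)
  have cn: "c v < n" if "v \<in> pverts G" for v
    using c that by (auto simp: bij_betw_def)
  have sym: "(v, u) \<in> parcs G" if "(u, v) \<in> parcs G" for u v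
    using that pair_sym_arcs by (auto simp: symmetric_def dest: symD)
  define I :: "'a \<Rightarrow> nat \<Rightarrow> real set" where
    "I = (\<lambda>v i. if w i = v then {0..0} else if (w i, v) \<in> parcs G then {0..1} else {1..1})"
  define B where "B = (\<lambda>v. Pi\<^sub>E {..<Suc n} (I v))"
  have ivl: "real_interval (I v i)" "bounded (I v i)" for v i
    unfolding I_def real_interval_def
    by (auto simp del: atLeastAtMost_singleton simp: is_interval_cc)
  have "local_box (Suc n) (Suc n) (B v)" for v
    unfolding local_box_def B_def using ivl by (intro conjI exI[of _ "I v"]) auto
  moreover have "(u, v) \<in> parcs G \<longleftrightarrow> B u \<inter> B v \<noteq> {}"
    if uv: "u \<in> pverts G" "v \<in> pverts G" "u \<noteq> v" for u v
  proof
    assume e: "(u, v) \<in> parcs G"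
    have ne: "I u i \<inter> I v i \<noteq> {}" for i
      using e sym[OF e] uv unfolding I_def by auto
    have "B u \<inter> B v = Pi\<^sub>E {..<Suc n} (\<lambda>i. I u i \<inter> I v i)"
      unfolding B_def by (rule PiE_Int)
    then show "B u \<inter> B v \<noteq> {}"
      using ne by (simp add: PiE_eq_empty_iff)
  next
    assume "B u \<inter> B v \<noteq> {}"
    then obtain x where x: "x \<in> B u" "x \<in> B v"
      by blast
    have "c u \<in> {..<Suc n}"
      using cn[OF uv(1)] by simp
    then have "x (c u) \<in> I u (c u)" "x (c u) \<in> I v (c u)"
      using x unfolding B_def by (auto dest: PiE_mem)
    then show "(u, v) \<in> parcs G"
      using uv wc[OF uv(1)] by (auto simp: I_def split: if_splits)
  qed
  ultimately have "local_box_representation G (Suc n) (Suc n) B"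
    by (auto simp: local_box_representation_def)
  then show ?thesis
    unfolding local_boxicity_def
    by (rule_tac LeastI[where P = "\<lambda>d. \<exists>d' B. local_box_representation G d d' B"]) blast
qed

end

theory Submission
  imports Defs
begin

text \<open>Intervals may be taken compact, and each vertex \<open>v\<close> gets a set \<open>S v\<close> of exactly two dimensions
  outside which its box is unbounded. Vertices with pairwise disjoint sets \<open>S v\<close> form a clique, so a
  maximal such family yields a set of at most \<open>2r\<close> dimensions meeting every \<open>S v\<close>, and one may colour
  separately the vertices \<open>v\<close> with a common dimension \<open>i \<in> S v\<close>. They are adjacent iff their intervals
  in dimension \<open>i\<close> meet and, provided that their second dimensions (labels) agree, the intervals in
  that dimension meet as well. Splitting into \<open>\<lfloor>log r\<rfloor> + 1\<close> dyadic scales according to how large the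
  cliques with a given label are, and separating different labels by an interval colouring, leaves
  rectangle intersection graphs of clique number \<open>w = O(2\<^sup>\<kappa>)\<close>, with at most \<open>r / 2\<^sup>\<kappa>\<close> colours used for
  the labels. The classical bound \<open>O(w\<^sup>2)\<close> for rectangles thus gives \<open>O(r\<^sup>2)\<close> colours per scale.\<close>

section \<open>Colourings of finite sets with a binary relation\<close>

text \<open>As \<open>pairwise\<close> ignores the diagonal, reflexive relations such as interval
  overlap can serve as adjacency without removing loops.\<close>

definition colourable :: "'a set \<Rightarrow> ('a \<Rightarrow> 'a \<Rightarrow> bool) \<Rightarrow> nat \<Rightarrow> bool" where
  "colourable V E k \<longleftrightarrow>
     (\<exists>c :: 'a \<Rightarrow> nat. c ` V \<subseteq> {..<k} \<and> pairwise (\<lambda>u v. E u v \<longrightarrow> c u \<noteq> c v) V)"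

text \<open>For nonempty compact intervals \<open>[a u, b u]\<close> and \<open>[a v, b v]\<close>
  this says that they intersect.\<close>

definition overlap :: "('a \<Rightarrow> real) \<Rightarrow> ('a \<Rightarrow> real) \<Rightarrow> 'a \<Rightarrow> 'a \<Rightarrow> bool" where
  "overlap a b u v \<longleftrightarrow> a u \<le> b v \<and> a v \<le> b u"

lemma colourable_mono:
  assumes "colourable V E k" "k \<le> k'"
  shows "colourable V E k'"
  using assms unfolding colourable_def by (meson lessThan_subset_iff order_trans)

lemma colourable_weaken:
  assumes "colourable V F k"
    and "\<And>u v. u \<in> V \<Longrightarrow> v \<in> V \<Longrightarrow> u \<noteq> v \<Longrightarrow> E u v \<Longrightarrow> F u v"
  shows "colourable V E k"
  using assms unfolding colourable_def pairwise_def by meson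

lemma colourable_partition:
  assumes f: "f ` V \<subseteq> {..<m}"
    and col: "\<And>i. i < m \<Longrightarrow> colourable {v \<in> V. f v = i} E k"
  shows "colourable V E (m * k)"
proof -
  have "\<forall>i\<in>{..<m}. \<exists>c :: 'a \<Rightarrow> nat.
      c ` {v \<in> V. f v = i} \<subseteq> {..<k} \<and> pairwise (\<lambda>u v. E u v \<longrightarrow> c u \<noteq> c v) {v \<in> V. f v = i}"
    using col by (auto simp: colourable_def)
  from bchoice[OF this] obtain c :: "nat \<Rightarrow> 'a \<Rightarrow> nat" where c: "\<And>i. i < m \<Longrightarrow>
      c i ` {v \<in> V. f v = i} \<subseteq> {..<k} \<and> pairwise (\<lambda>u v. E u v \<longrightarrow> c i u \<noteq> c i v) {v \<in> V. f v = i}"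
    by auto
  \<comment> \<open>The pair of the class and the colour inside it, written as one number in base
    \<open>k\<close>; \<open>div\<close> and \<open>mod\<close> recover it.\<close>
  define g where "g v = f v * k + c (f v) v" for v
  have ck: "c (f v) v < k" "f v < m" if "v \<in> V" for v
    using c[of "f v"] f that by auto
  have "g v < m * k" if "v \<in> V" for v
  proof -
    have "g v < (f v + 1) * k"
      using ck[OF that] by (simp add: g_def)
    also have "\<dots> \<le> m * k"
      using ck[OF that] by (intro mult_le_mono1) simp
    finally show ?thesis .
  qed
  moreover have "g u \<noteq> g v" if uv: "u \<in> V" "v \<in> V" "u \<noteq> v" "E u v" for u v
  proof
    assume eq: "g u = g v"
    have "f w = g w div k" "c (f w) w = g w mod k" if "w \<in> V" for w
      using ck[OF that] by (auto simp: g_def)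
    then have "f u = f v" "c (f u) u = c (f v) v"
      using eq uv by metis+
    with c[of "f u"] ck[OF uv(1)] uv show False
      by (auto simp: pairwise_def)
  qed
  ultimately show ?thesis
    unfolding colourable_def pairwise_def by (intro exI[of _ g]) auto
qed

text \<open>Greedy colouring: a vertex with fewer than \<open>k\<close> neighbours is removed, the
  rest is coloured by induction, and some colour remains free for it.\<close>

lemma colourable_degenerate:
  assumes "finite V"
    and sym: "\<And>u v. E u v \<longleftrightarrow> E v u"
    and "\<And>W. W \<subseteq> V \<Longrightarrow> W \<noteq> {} \<Longrightarrow> \<exists>v\<in>W. card {u \<in> W - {v}. E u v} < k"
  shows "colourable V E k"
  using assms(1,3)
proof (induction V rule: finite_remove_induct)
  case empty
  then show ?case by (simp add: colourable_def)
next
  case (remove V)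
  obtain v where v: "v \<in> V" "card {u \<in> V - {v}. E u v} < k"
    using remove.prems[of V] remove.hyps by auto
  obtain c :: "'a \<Rightarrow> nat" where c: "c ` (V - {v}) \<subseteq> {..<k}"
      "pairwise (\<lambda>u w. E u w \<longrightarrow> c u \<noteq> c w) (V - {v})"
    using remove.IH[OF v(1)] remove.prems unfolding colourable_def by blast
  define N where "N = {u \<in> V - {v}. E u v}"
  have "finite N"
    using remove.hyps by (simp add: N_def)
  then have "card (c ` N) < card {..<k}"
    using v card_image_le[of N c] by (auto simp: N_def)
  then obtain i where i: "i < k" "i \<notin> c ` N"
    by (metis \<open>finite N\<close> card_mono finite_imageI lessThan_iff not_less subsetI)
  have "(c(v := i)) ` V \<subseteq> {..<k}"
    using c i by auto
  moreover have "pairwise (\<lambda>u w. E u w \<longrightarrow> (c(v := i)) u \<noteq> (c(v := i)) w) V"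
    using c(2) i sym unfolding pairwise_def N_def by auto
  ultimately show ?case
    unfolding colourable_def by blast
qed

text \<open>Any \<open>W\<close> spans at most \<open>k * card W\<close> arcs of \<open>A\<close>,
  and these cover all adjacencies. Hence the average degree is at most \<open>2 * k\<close>, and the
  greedy bound applies.\<close>

lemma colourable_outdegree:
  assumes fin: "finite V"
    and sym: "\<And>u v. E u v \<longleftrightarrow> E v u"
    and orient: "\<And>u v. u \<in> V \<Longrightarrow> v \<in> V \<Longrightarrow> u \<noteq> v \<Longrightarrow> E u v \<Longrightarrow> A u v \<or> A v u"
    and out: "\<And>v. v \<in> V \<Longrightarrow> card {u \<in> V - {v}. A v u} \<le> k"
  shows "colourable V E (2 * k + 1)"
proof (rule colourable_degenerate[OF fin sym])
  fix W assume W: "W \<subseteq> V" "W \<noteq> {}"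
  have finW: "finite W"
    using W fin finite_subset by blast
  define P where "P = {(v, u). v \<in> W \<and> u \<in> W \<and> u \<noteq> v \<and> A v u}"
  have "card P = (\<Sum>v\<in>W. card {u \<in> W - {v}. A v u})"
  proof -
    have "P = (SIGMA v:W. {u \<in> W - {v}. A v u})"
      by (auto simp: P_def)
    then show ?thesis
      using finW by simp
  qed
  \<comment> \<open>The same arcs, counted by their heads: in-degrees and out-degrees have equal
    sums.\<close>
  moreover have "card P = (\<Sum>v\<in>W. card {u \<in> W - {v}. A u v})"
  proof -
    have "P\<inverse> = (SIGMA v:W. {u \<in> W - {v}. A u v})"
      by (auto simp: P_def)
    then have "card (P\<inverse>) = (\<Sum>v\<in>W. card {u \<in> W - {v}. A u v})"
      using finW by simp
    then show ?thesis
      by simp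
  qed
  moreover have "(\<Sum>v\<in>W. card {u \<in> W - {v}. A v u}) \<le> (\<Sum>v\<in>W. k)"
  proof (rule sum_mono)
    fix v assume v: "v \<in> W"
    have "card {u \<in> W - {v}. A v u} \<le> card {u \<in> V - {v}. A v u}"
      by (rule card_mono) (use fin W in auto)
    then show "card {u \<in> W - {v}. A v u} \<le> k"
      using out[of v] v W by auto
  qed
  moreover have "(\<Sum>v\<in>W. card {u \<in> W - {v}. E u v}) \<le>
      (\<Sum>v\<in>W. card {u \<in> W - {v}. A v u} + card {u \<in> W - {v}. A u v})"
  proof (rule sum_mono)
    fix v assume v: "v \<in> W"
    have "{u \<in> W - {v}. E u v} \<subseteq> {u \<in> W - {v}. A v u} \<union> {u \<in> W - {v}. A u v}"
      using orient W v by auto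
    then have "card {u \<in> W - {v}. E u v} \<le> card ({u \<in> W - {v}. A v u} \<union> {u \<in> W - {v}. A u v})"
      by (rule card_mono[rotated]) (use finW in auto)
    also have "\<dots> \<le> card {u \<in> W - {v}. A v u} + card {u \<in> W - {v}. A u v}"
      by (rule card_Un_le)
    finally show "card {u \<in> W - {v}. E u v} \<le> \<dots>" .
  qed
  ultimately have le: "(\<Sum>v\<in>W. card {u \<in> W - {v}. E u v}) \<le> card W * (2 * k)"
    by (simp add: sum.distrib)
  show "\<exists>v\<in>W. card {u \<in> W - {v}. E u v} < 2 * k + 1"
  proof (rule ccontr)
    assume "\<not> ?thesis"
    then have "(\<Sum>v\<in>W. 2 * k + 1) \<le> (\<Sum>v\<in>W. card {u \<in> W - {v}. E u v})"
      by (intro sum_mono) (auto simp: not_less)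
    then have "card W * (2 * k + 1) \<le> card W * (2 * k)"
      using le by simp
    then show False
      using W finW by simp
  qed
qed

section \<open>Strict orders and rectangle intersection graphs\<close>

text \<open>Mirsky's argument: the colour of \<open>v\<close> is its height, the size of a largest
  chain with top element \<open>v\<close>, lowered by one to start at 0.\<close>

lemma colourable_bounded_chains:
  fixes R :: "'a \<Rightarrow> 'a \<Rightarrow> bool"
  assumes fin: "finite V"
    and irr: "\<And>u. \<not> R u u"
    and trans: "\<And>u v w. R u v \<Longrightarrow> R v w \<Longrightarrow> R u w"
    and chains: "\<And>C. C \<subseteq> V \<Longrightarrow> pairwise (\<lambda>u v. R u v \<or> R v u) C \<Longrightarrow> card C \<le> w"
  shows "colourable V (\<lambda>u v. R u v \<or> R v u) w"
proof -
  define Ch where "Ch v = {C. C \<subseteq> V \<and> pairwise (\<lambda>u v. R u v \<or> R v u) C \<and> v \<in> C \<and>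
      (\<forall>u\<in>C. u \<noteq> v \<longrightarrow> R u v)}" for v
  define h where "h v = Max (card ` Ch v)" for v
  have finCh: "finite (Ch v)" for v
    by (rule finite_subset[of _ "Pow V"]) (use fin in \<open>auto simp: Ch_def\<close>)
  have single: "{v} \<in> Ch v" if "v \<in> V" for v
    using that by (auto simp: Ch_def)
  have att: "\<exists>C\<in>Ch v. h v = card C" if "v \<in> V" for v
  proof -
    have "h v \<in> card ` Ch v"
      unfolding h_def using finCh single[OF that] by (intro Max_in) auto
    then show ?thesis by auto
  qed
  have ge: "card C \<le> h v" if "C \<in> Ch v" for C v
    unfolding h_def using finCh that by (intro Max_ge) auto
  have bounds: "1 \<le> h v" "h v \<le> w" if "v \<in> V" for v
    using ge[OF single[OF that]] att[OF that] chains by (auto simp: Ch_def)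
  have less: "h u < h v" if uv: "u \<in> V" "v \<in> V" "R u v" for u v
  proof -
    obtain C where C: "C \<in> Ch u" "h u = card C"
      using att uv by blast
    have "R x v" if "x \<in> C" for x
      using C that uv trans by (cases "x = u") (auto simp: Ch_def)
    then have "insert v C \<in> Ch v" "v \<notin> C"
      using C uv irr by (auto simp: Ch_def pairwise_insert)
    moreover have "finite C"
      using C fin by (auto simp: Ch_def intro: finite_subset)
    ultimately show ?thesis
      using ge[of "insert v C" v] C by simp
  qed
  have "(\<lambda>v. h v - 1) ` V \<subseteq> {..<w}"
    using bounds by fastforce
  moreover have "pairwise (\<lambda>u v. R u v \<or> R v u \<longrightarrow> h u - 1 \<noteq> h v - 1) V"
  proof (rule pairwiseI, rule impI)
    fix u v assume "u \<in> V" "v \<in> V" "R u v \<or> R v u"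
    then have "h u \<noteq> h v"
      using less by (metis nat_neq_iff)
    then show "h u - 1 \<noteq> h v - 1"
      using bounds[OF \<open>u \<in> V\<close>] bounds[OF \<open>v \<in> V\<close>] by linarith
  qed
  ultimately show ?thesis
    unfolding colourable_def by (intro exI[of _ "\<lambda>v. h v - 1"]) auto
qed

text \<open>Chains for crossing are cliques, so \<open>w\<close> classes suffice to remove
  crossings. Inside a class, arcs towards the rectangles containing a corner have out-degree at most
  \<open>4 * (w - 1)\<close>.\<close>

lemma colourable_rectangles:
  fixes a b c d :: "'a \<Rightarrow> real"
  assumes fin: "finite V"
    and ab: "\<And>v. a v \<le> b v" and cd: "\<And>v. c v \<le> d v"
    and cl: "\<And>Q. Q \<subseteq> V \<Longrightarrow> pairwise (\<lambda>u v. overlap a b u v \<and> overlap c d u v) Q \<Longrightarrow> card Q \<le> w"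
  shows "colourable V (\<lambda>u v. overlap a b u v \<and> overlap c d u v) (8 * w\<^sup>2)"
proof (cases "V = {}")
  case True
  then show ?thesis by (simp add: colourable_def)
next
  case False
  then obtain v0 where "v0 \<in> V" by blast
  then have w: "1 \<le> w"
    using cl[of "{v0}"] by simp
  let ?E = "\<lambda>u v. overlap a b u v \<and> overlap c d u v"
  \<comment> \<open>\<open>X u v\<close>: the rectangle of \<open>u\<close> crosses that of \<open>v\<close> vertically. Without crossings, one of two
    intersecting rectangles has a corner in the other, and a corner lies in at most \<open>w\<close>
    rectangles.\<close>
  define X where "X u v \<longleftrightarrow> a v \<le> a u \<and> b u \<le> b v \<and> c u \<le> c v \<and> d v \<le> d u" for u v
  \<comment> \<open>The strict part of \<open>X\<close> is irreflexive, as the chain bound requires.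
    Only pairs of identical rectangles are lost, and these contain each other's corners.\<close>
  define R where "R u v \<longleftrightarrow> X u v \<and> \<not> X v u" for u v
  have XE: "?E u v" if "X u v" for u v
    using that ab[of u] cd[of v] by (auto simp: X_def overlap_def)
  have Xtrans: "X u w" if "X u v" "X v w" for u v w
    using that by (auto simp: X_def)
  have "colourable V (\<lambda>u v. R u v \<or> R v u) w"
  proof (rule colourable_bounded_chains[OF fin])
    show "\<And>u. \<not> R u u" by (simp add: R_def)
    show "\<And>u v w. R u v \<Longrightarrow> R v w \<Longrightarrow> R u w"
      unfolding R_def using Xtrans by blast
    show "card C \<le> w" if "C \<subseteq> V" "pairwise (\<lambda>u v. R u v \<or> R v u) C" for C
    proof (rule cl[OF that(1)], rule pairwiseI)
      fix u v assume "u \<in> C" "v \<in> C" "u \<noteq> v"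
      then have "X u v \<or> X v u"
        using that(2) by (auto simp: pairwise_def R_def)
      then show "?E u v"
        using XE[of u v] XE[of v u] by (auto simp: overlap_def)
    qed
  qed
  then obtain f :: "'a \<Rightarrow> nat" where f: "f ` V \<subseteq> {..<w}"
      "pairwise (\<lambda>u v. R u v \<or> R v u \<longrightarrow> f u \<noteq> f v) V"
    unfolding colourable_def by blast
  have "colourable V ?E (w * (2 * (4 * (w - 1)) + 1))"
  proof (rule colourable_partition[OF f(1)])
    fix i
    define W where "W = {v \<in> V. f v = i}"
    define stab where "stab x y = {u \<in> W. a u \<le> x \<and> x \<le> b u \<and> c u \<le> y \<and> y \<le> d u}" for x y
    \<comment> \<open>An arc from \<open>v\<close> to \<open>u\<close> means that \<open>u\<close>
      contains a corner of \<open>v\<close>.\<close>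
    define A where "A v u \<longleftrightarrow> u \<in> stab (a v) (c v) \<union> stab (a v) (d v) \<union> stab (b v) (c v) \<union> stab (b v) (d v)"
      for v u
    have finstab: "finite (stab x y)" for x y
      using fin by (simp add: stab_def W_def)
    have "colourable W ?E (2 * (4 * (w - 1)) + 1)"
    proof (rule colourable_outdegree[where A = A])
      show "finite W" using fin by (simp add: W_def)
      show "\<And>u v. ?E u v \<longleftrightarrow> ?E v u" by (auto simp: overlap_def)
    next
      fix u v assume uv: "u \<in> W" "v \<in> W" "u \<noteq> v" "?E u v"
      have "\<not> R u v" "\<not> R v u"
        using f(2) uv by (auto simp: pairwise_def W_def)
      then show "A u v \<or> A v u"
        using uv ab[of u] ab[of v] cd[of u] cd[of v]
        unfolding A_def stab_def R_def X_def overlap_def Un_iff mem_Collect_eq by (smt (verit))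
    next
      fix v assume v: "v \<in> W"
      \<comment> \<open>Rectangles through a common point form a clique, and \<open>v\<close> itself
        is one of them.\<close>
      have pt: "card (stab x y - {v}) \<le> w - 1" if "v \<in> stab x y" for x y
      proof -
        have "card (stab x y) \<le> w"
          by (rule cl) (auto simp: stab_def W_def pairwise_def overlap_def)
        then show ?thesis
          using that finstab by (simp add: card_Diff_singleton)
      qed
      have "{u \<in> W - {v}. A v u} \<subseteq> (stab (a v) (c v) - {v}) \<union> (stab (a v) (d v) - {v}) \<union>
          ((stab (b v) (c v) - {v}) \<union> (stab (b v) (d v) - {v}))"
        by (auto simp: A_def)
      then have "card {u \<in> W - {v}. A v u} \<le> card ((stab (a v) (c v) - {v}) \<union> (stab (a v) (d v) - {v}) \<union>
          ((stab (b v) (c v) - {v}) \<union> (stab (b v) (d v) - {v})))"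
        by (rule card_mono[rotated]) (use finstab in auto)
      also have "\<dots> \<le> card (stab (a v) (c v) - {v}) + card (stab (a v) (d v) - {v}) +
          (card (stab (b v) (c v) - {v}) + card (stab (b v) (d v) - {v}))"
        by (intro order_trans[OF card_Un_le] add_mono card_Un_le)
      also have "\<dots> \<le> (w - 1) + (w - 1) + ((w - 1) + (w - 1))"
        using v ab cd by (intro add_mono pt) (auto simp: stab_def)
      finally show "card {u \<in> W - {v}. A v u} \<le> 4 * (w - 1)"
        by simp
    qed
    then show "colourable {v \<in> V. f v = i} ?E (2 * (4 * (w - 1)) + 1)"
      by (simp add: W_def)
  qed
  moreover have "w * (2 * (4 * (w - 1)) + 1) \<le> 8 * w\<^sup>2"
  proof -
    have "w * (2 * (4 * (w - 1)) + 1) \<le> w * (8 * w)"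
      using w by (intro mult_le_mono2) linarith
    then show ?thesis by (simp add: power2_eq_square)
  qed
  ultimately show ?thesis
    by (rule colourable_mono)
qed

section \<open>Intervals with labels\<close>

text \<open>Greedy interval colouring by left endpoints, with labels in the place of vertices. Far
  apart, a colour may be reused for another label and a label may change its colour.\<close>

lemma colouring_by_labels:
  fixes a b :: "'a \<Rightarrow> real" and l :: "'a \<Rightarrow> 'b"
  assumes fin: "finite V"
    and ab: "\<And>v. a v \<le> b v"
    and "\<And>x. card (l ` {v \<in> V. a v \<le> x \<and> x \<le> b v}) \<le> m"
  shows "\<exists>f :: 'a \<Rightarrow> nat. f ` V \<subseteq> {..<m} \<and>
    (\<forall>u\<in>V. \<forall>v\<in>V. overlap a b u v \<longrightarrow> (f u = f v \<longleftrightarrow> l u = l v))"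
  using fin assms(3)
proof (induction V rule: finite_ranking_induct[where f = a])
  case empty
  then show ?case by auto
next
  case (insert v V)
  show ?case
  proof (cases "v \<in> V")
    case True
    then show ?thesis
      using insert by (simp add: insert_absorb)
  next
    case False
    have "card (l ` {u \<in> V. a u \<le> x \<and> x \<le> b u}) \<le> m" for x
      using insert.prems[of x] insert.hyps(1)
      by (intro order_trans[OF _ insert.prems[of x]] card_mono) auto
    then obtain f :: "'a \<Rightarrow> nat" where f: "f ` V \<subseteq> {..<m}"
      "\<And>u u'. u \<in> V \<Longrightarrow> u' \<in> V \<Longrightarrow> overlap a b u u' \<Longrightarrow> f u = f u' \<longleftrightarrow> l u = l u'"
      using insert.IH by blast
    \<comment> \<open>Since \<open>a v\<close> is maximal, the earlier intervals meeting that of \<open>v\<close> all contain \<open>a v\<close>.\<close>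
    define N where "N = {u \<in> V. a v \<le> b u}"
    have ov: "overlap a b u v \<longleftrightarrow> u \<in> N" "overlap a b v u \<longleftrightarrow> u \<in> N" if "u \<in> V" for u
      using insert.hyps(2)[OF that] ab[of v] that by (auto simp: overlap_def N_def)
    have NN: "f u = f u' \<longleftrightarrow> l u = l u'" if "u \<in> N" "u' \<in> N" for u u'
      using that f(2)[of u u'] insert.hyps(2) by (force simp: N_def overlap_def)
    \<comment> \<open>If the label of \<open>v\<close> occurs in \<open>N\<close>, its colour there
      is forced; otherwise a colour absent from \<open>N\<close> is needed.\<close>
    have "\<exists>i<m. \<forall>u\<in>N. f u = i \<longleftrightarrow> l u = l v"
    proof (cases "l v \<in> l ` N")
      case True
      then obtain u where u: "u \<in> N" "l u = l v" by auto
      then show ?thesis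
        using NN[OF _ u(1)] f(1) by (intro exI[of _ "f u"]) (auto simp: N_def)
    next
      case False
      have finN: "finite N" using insert.hyps by (simp add: N_def)
      \<comment> \<open>On \<open>N\<close> colours and labels correspond bijectively. Together with
        the new label \<open>l v\<close> there are at most \<open>m\<close> labels above
        \<open>a v\<close>, so a colour is free.\<close>
      have "card (f ` N) = card (l ` N)"
      proof -
        define g where "g i = l (SOME u. u \<in> N \<and> f u = i)" for i
        have g: "g (f u) = l u" if "u \<in> N" for u
        proof -
          have "(SOME u'. u' \<in> N \<and> f u' = f u) \<in> N \<and> f (SOME u'. u' \<in> N \<and> f u' = f u) = f u"
            by (rule someI[of _ u]) (use that in auto)
          then show ?thesis
            using NN[of "SOME u'. u' \<in> N \<and> f u' = f u" u] that by (simp add: g_def)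
        qed
        then have "inj_on g (f ` N)"
          using NN by (auto intro!: inj_onI)
        moreover have "g ` f ` N = l ` N"
          using g by (auto simp: image_image)
        ultimately show ?thesis
          by (metis card_image)
      qed
      also have "\<dots> < card (insert (l v) (l ` N))"
        using False finN by simp
      also have "insert (l v) (l ` N) = l ` {u \<in> insert v V. a u \<le> a v \<and> a v \<le> b u}"
        using insert.hyps(2) ab[of v] by (auto simp: N_def)
      also have "card \<dots> \<le> card {..<m}"
        using insert.prems by simp
      finally obtain i where "i < m" "i \<notin> f ` N"
        by (metis finN card_mono finite_imageI lessThan_iff not_less subsetI)
      then show ?thesis
        using False by (metis imageI)
    qed
    then obtain i where i: "i < m" "\<And>u. u \<in> N \<Longrightarrow> f u = i \<longleftrightarrow> l u = l v"
      by blast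
    have "(f(v := i)) ` insert v V \<subseteq> {..<m}"
      using f(1) i(1) by auto
    moreover have "(f(v := i)) u = (f(v := i)) u' \<longleftrightarrow> l u = l u'"
      if "u \<in> insert v V" "u' \<in> insert v V" "overlap a b u u'" for u u'
    proof (cases "u = v"; cases "u' = v")
      assume "u = v" "u' \<noteq> v"
      then show ?thesis
        using that ov i(2)[of u'] by auto
    next
      assume "u \<noteq> v" "u' = v"
      then show ?thesis
        using that ov i(2)[of u] by auto
    next
      assume "u \<noteq> v" "u' \<noteq> v"
      then show ?thesis
        using that f(2)[of u u'] by auto
    qed auto
    ultimately show ?thesis by blast
  qed
qed

text \<open>This is the situation of vertices sharing a dimension: \<open>[a v, b v]\<close> is the
  interval there, \<open>l v\<close> names the second dimension, and \<open>[c v, d v]\<close> is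
  the interval in it.\<close>

lemma colourable_labelled_intervals:
  fixes a b c d :: "'a \<Rightarrow> real" and l :: "'a \<Rightarrow> 'b"
  assumes fin: "finite V"
    and ab: "\<And>v. a v \<le> b v" and cd: "\<And>v. c v \<le> d v"
    and cl: "\<And>Q. Q \<subseteq> V \<Longrightarrow>
        pairwise (\<lambda>u v. overlap a b u v \<and> (l u = l v \<longrightarrow> overlap c d u v)) Q \<Longrightarrow> card Q \<le> r"
    and K: "r < 2 ^ K"
  shows "colourable V (\<lambda>u v. overlap a b u v \<and> (l u = l v \<longrightarrow> overlap c d u v)) (K * (128 * r\<^sup>2))"
proof -
  let ?E = "\<lambda>u v. overlap a b u v \<and> (l u = l v \<longrightarrow> overlap c d u v)"
  \<comment> \<open>The vertices are split by the dyadic scale of \<open>m v\<close>, the smallest size over \<open>x\<close> in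
    \<open>[a v, b v]\<close> of a largest clique above \<open>x\<close> with the label of \<open>v\<close>. At scale \<open>\<kappa>\<close> at most
    \<open>r / 2 ^ \<kappa>\<close> labels occur above any point, while one label only has cliques of size
    \<open>O(2 ^ \<kappa>)\<close>.\<close>
  define F where "F L x = {Q. Q \<subseteq> V \<and> (\<forall>v\<in>Q. l v = L \<and> a v \<le> x \<and> x \<le> b v) \<and>
      pairwise (overlap c d) Q}" for L x
  define w where "w L x = Max (card ` F L x)" for L x
  have finF: "finite (F L x)" for L x
    by (rule finite_subset[of _ "Pow V"]) (use fin in \<open>auto simp: F_def\<close>)
  have w_ge: "card Q \<le> w L x" if "Q \<in> F L x" for Q L x
    unfolding w_def using finF that by (intro Max_ge) auto
  have w_att: "\<exists>Q\<in>F L x. w L x = card Q" for L x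
  proof -
    have "{} \<in> F L x"
      by (auto simp: F_def)
    then have "w L x \<in> card ` F L x"
      unfolding w_def using finF by (intro Max_in) auto
    then show ?thesis by auto
  qed
  have w_le: "w L x \<le> r" for L x
  proof -
    obtain Q where Q: "Q \<in> F L x" "w L x = card Q"
      using w_att by blast
    have "?E u v" if "u \<in> Q" "v \<in> Q" "u \<noteq> v" for u v
    proof -
      have "a u \<le> x" "x \<le> b u" "a v \<le> x" "x \<le> b v"
        using Q(1) that by (auto simp: F_def)
      moreover have "overlap c d u v"
        using Q(1) that by (auto simp: F_def pairwise_def)
      ultimately show ?thesis
        by (auto simp: overlap_def)
    qed
    then have "pairwise ?E Q"
      by (rule pairwiseI)
    then show ?thesis
      using cl[of Q] Q by (simp add: F_def)
  qed
  \<comment> \<open>A least element of a set of naturals is attained even though \<open>x\<close>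
    ranges over an infinite interval.\<close>
  define m where "m v = (LEAST n. n \<in> w (l v) ` {a v..b v})" for v
  have m_att: "\<exists>x. a v \<le> x \<and> x \<le> b v \<and> w (l v) x = m v" for v
  proof -
    have "w (l v) (a v) \<in> w (l v) ` {a v..b v}"
      using ab[of v] by auto
    then have "m v \<in> w (l v) ` {a v..b v}"
      unfolding m_def by (rule LeastI)
    then show ?thesis by auto
  qed
  have m_le: "m v \<le> w (l v) x" if "a v \<le> x" "x \<le> b v" for v x
    unfolding m_def by (rule Least_le) (use that in auto)
  have m_bounds: "1 \<le> m v" "m v \<le> r" if v: "v \<in> V" for v
  proof -
    obtain x where x: "a v \<le> x" "x \<le> b v" "w (l v) x = m v"
      using m_att by blast
    then have "{v} \<in> F (l v) x"
      using v by (auto simp: F_def)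
    then show "1 \<le> m v"
      using w_ge x(3) by fastforce
    show "m v \<le> r"
      using w_le x(3) by metis
  qed
  have "\<forall>v\<in>V. \<exists>k. 2 ^ k \<le> m v \<and> m v < 2 ^ (k + 1)"
    using m_bounds(1) by (intro ballI ex_power_ivl1) auto
  from bchoice[OF this] obtain k where k: "\<And>v. v \<in> V \<Longrightarrow> 2 ^ k v \<le> m v \<and> m v < 2 ^ (k v + 1)"
    by blast
  have "k v < K" if v: "v \<in> V" for v
  proof -
    have "2 ^ k v < (2 :: nat) ^ K"
      using k[OF v] m_bounds(2)[OF v] K by linarith
    then show ?thesis
      by (rule power_less_imp_less_exp[rotated]) simp
  qed
  then have "k ` V \<subseteq> {..<K}"
    by auto
  then show ?thesis
  proof (rule colourable_partition)
    fix \<kappa>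
    define W where "W = {v \<in> V. k v = \<kappa>}"
    \<comment> \<open>Largest cliques above \<open>x\<close> are chosen for all labels present.
      Distinct labels impose no condition on \<open>c\<close> and \<open>d\<close>, so the disjoint
      union is again a clique; each part has size at least \<open>2 ^ \<kappa>\<close>.\<close>
    have labels: "card (l ` {v \<in> W. a v \<le> x \<and> x \<le> b v}) \<le> r div 2 ^ \<kappa>" for x
    proof -
      define A where "A = l ` {v \<in> W. a v \<le> x \<and> x \<le> b v}"
      have finA: "finite A"
        using fin by (simp add: A_def W_def)
      have "\<forall>L. \<exists>Q. Q \<in> F L x \<and> w L x = card Q"
        using w_att by blast
      from choice[OF this] obtain Q where Q: "\<And>L. Q L \<in> F L x \<and> w L x = card (Q L)"
        by blast
      have finQ: "finite (Q L)" for L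
        using Q[of L] fin by (auto simp: F_def intro: finite_subset)
      have "2 ^ \<kappa> \<le> card (Q L)" if L: "L \<in> A" for L
      proof -
        obtain v where v: "v \<in> V" "k v = \<kappa>" "a v \<le> x" "x \<le> b v" "L = l v"
          using L by (auto simp: A_def W_def)
        then have "2 ^ \<kappa> \<le> m v"
          using k by blast
        also have "\<dots> \<le> card (Q L)"
          using m_le v Q by metis
        finally show ?thesis .
      qed
      moreover have lQ: "l v = L" if "v \<in> Q L" for v L
        using Q[of L] that by (auto simp: F_def)
      ultimately have "(\<Sum>L\<in>A. 2 ^ \<kappa>) \<le> (\<Sum>L\<in>A. card (Q L))"
        by (intro sum_mono)
      also have "\<dots> = card (\<Union>L\<in>A. Q L)"
        using finA finQ lQ by (intro card_UN_disjoint[symmetric]) blast+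
      also have "\<dots> \<le> r"
      proof (rule cl)
        show "(\<Union>L\<in>A. Q L) \<subseteq> V"
          using Q by (auto simp: F_def)
        show "pairwise ?E (\<Union>L\<in>A. Q L)"
        proof (rule pairwiseI)
          fix u v assume "u \<in> (\<Union>L\<in>A. Q L)" "v \<in> (\<Union>L\<in>A. Q L)" "u \<noteq> v"
          then obtain L L' where L: "u \<in> Q L" "v \<in> Q L'"
            by blast
          have "l u = L" "a u \<le> x" "x \<le> b u" "l v = L'" "a v \<le> x" "x \<le> b v"
            using Q[of L] Q[of L'] L by (auto simp: F_def)
          moreover have "overlap c d u v" if "L = L'"
            using Q[of L] L that \<open>u \<noteq> v\<close> by (auto simp: F_def pairwise_def)
          ultimately show "?E u v"
            by (auto simp: overlap_def)
        qed
      qed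
      finally show ?thesis
        by (simp add: less_eq_div_iff_mult_less_eq A_def)
    qed
    have finW: "finite W"
      using fin by (simp add: W_def)
    obtain f :: "'a \<Rightarrow> nat" where f: "f ` W \<subseteq> {..<r div 2 ^ \<kappa>}"
      "\<And>u v. u \<in> W \<Longrightarrow> v \<in> W \<Longrightarrow> overlap a b u v \<Longrightarrow> f u = f v \<longleftrightarrow> l u = l v"
      using colouring_by_labels[OF finW ab labels] by blast
    have "colourable W ?E (r div 2 ^ \<kappa> * (8 * (2 ^ (\<kappa> + 2))\<^sup>2))"
    \<comment> \<open>Within a class of \<open>f\<close>, overlap of \<open>[a, b]\<close> forces
      equal labels, so adjacency becomes intersection of rectangles.\<close>
    proof (rule colourable_partition[OF f(1)])
      fix i
      define T where "T = {v \<in> W. f v = i}"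
      have "colourable T (\<lambda>u v. overlap a b u v \<and> overlap c d u v) (8 * (2 ^ (\<kappa> + 2))\<^sup>2)"
      proof (rule colourable_rectangles[OF _ ab cd])
        show "finite T"
          using finW by (simp add: T_def)
      next
        fix Q assume Q: "Q \<subseteq> T" "pairwise (\<lambda>u v. overlap a b u v \<and> overlap c d u v) Q"
        have finQ: "finite Q"
          using Q(1) finW by (auto simp: T_def intro: finite_subset)
        show "card Q \<le> 2 ^ (\<kappa> + 2)"
        proof (cases "Q = {}")
          case False
          then obtain q where q: "q \<in> Q" by blast
          \<comment> \<open>The vertices of \<open>Q\<close> share the point \<open>x\<close>. Among those whose point \<open>y v\<close> of low
            multiplicity lies right of \<open>x\<close>, all contain the leftmost such point; likewise on the
            left.\<close>
          define x where "x = Max (a ` Q)"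
          have ov: "overlap a b u v" if "u \<in> Q" "v \<in> Q" for u v
            using Q(2) that ab[of u] by (cases "u = v") (auto simp: pairwise_def overlap_def)
          have Qx: "a v \<le> x" "x \<le> b v" if v: "v \<in> Q" for v
          proof -
            show "a v \<le> x"
              unfolding x_def using finQ v by simp
            have "x \<in> a ` Q"
              unfolding x_def using finQ False by (intro Max_in) auto
            then show "x \<le> b v"
              using ov v by (auto simp: overlap_def)
          qed
          \<comment> \<open>Every member overlaps \<open>q\<close> and has the same colour under
            \<open>f\<close>, so \<open>Q\<close> carries a single label.\<close>
          have QV: "v \<in> V" "k v = \<kappa>" "l v = l q" if "v \<in> Q" for v
            using that Q(1) q f(2)[of v q] ov[OF that q] by (auto simp: T_def W_def)
          obtain y where y: "\<And>v. a v \<le> y v \<and> y v \<le> b v \<and> w (l v) (y v) = m v"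
            using m_att by metis
          \<comment> \<open>Such a \<open>P\<close> is a clique with one label above
            \<open>y p\<close>, where the largest one has size \<open>m p\<close>.\<close>
          have half: "card P < 2 ^ (\<kappa> + 1)"
            if P: "P \<subseteq> Q" "p \<in> P" "\<And>v. v \<in> P \<Longrightarrow> a v \<le> y p \<and> y p \<le> b v" for P p
          proof -
            have "P \<in> F (l q) (y p)"
              using P QV Q(2) unfolding F_def pairwise_def by blast
            then have "card P \<le> w (l q) (y p)"
              by (rule w_ge)
            also have "\<dots> = m p"
              using y[of p] QV P by force
            also have "\<dots> < 2 ^ (\<kappa> + 1)"
              using k[of p] QV[of p] P by auto
            finally show ?thesis .
          qed
          have right: "card {v \<in> Q. x \<le> y v} < 2 ^ (\<kappa> + 1)"
          proof (cases "{v \<in> Q. x \<le> y v} = {}")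
            case True
            show ?thesis
              unfolding True by simp
          next
            case False
            then have "Min (y ` {v \<in> Q. x \<le> y v}) \<in> y ` {v \<in> Q. x \<le> y v}"
              using finQ by (intro Min_in) simp_all
            then obtain p where p: "p \<in> {v \<in> Q. x \<le> y v}" "Min (y ` {v \<in> Q. x \<le> y v}) = y p"
              by (rule imageE)
            have p_min: "y p \<le> y v" if "v \<in> {v \<in> Q. x \<le> y v}" for v
              unfolding p(2)[symmetric] using finQ that by (intro Min_le) simp_all
            show ?thesis
            proof (rule half[OF _ p(1)])
              fix v assume v: "v \<in> {v \<in> Q. x \<le> y v}"
              show "a v \<le> y p \<and> y p \<le> b v"
                using p(1) p_min[OF v] v Qx[of v] y[of v] by auto
            qed auto
          qed
          have left: "card {v \<in> Q. y v \<le> x} < 2 ^ (\<kappa> + 1)"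
          proof (cases "{v \<in> Q. y v \<le> x} = {}")
            case True
            show ?thesis
              unfolding True by simp
          next
            case False
            then have "Max (y ` {v \<in> Q. y v \<le> x}) \<in> y ` {v \<in> Q. y v \<le> x}"
              using finQ by (intro Max_in) simp_all
            then obtain p where p: "p \<in> {v \<in> Q. y v \<le> x}" "Max (y ` {v \<in> Q. y v \<le> x}) = y p"
              by (rule imageE)
            have p_max: "y v \<le> y p" if "v \<in> {v \<in> Q. y v \<le> x}" for v
              unfolding p(2)[symmetric] using finQ that by (intro Max_ge) simp_all
            show ?thesis
            proof (rule half[OF _ p(1)])
              fix v assume v: "v \<in> {v \<in> Q. y v \<le> x}"
              show "a v \<le> y p \<and> y p \<le> b v"
                using p(1) p_max[OF v] v Qx[of v] y[of v] by auto
            qed auto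
          qed
          have "Q = {v \<in> Q. x \<le> y v} \<union> {v \<in> Q. y v \<le> x}"
            by auto
          then have "card Q \<le> card {v \<in> Q. x \<le> y v} + card {v \<in> Q. y v \<le> x}"
            by (metis card_Un_le)
          then show ?thesis
            using left right by simp
        qed simp
      qed
      moreover have "overlap a b u v \<and> overlap c d u v" if "u \<in> T" "v \<in> T" "?E u v" for u v
        using that f(2)[of u v] by (simp add: T_def)
      ultimately have "colourable T ?E (8 * (2 ^ (\<kappa> + 2))\<^sup>2)"
        by (rule colourable_weaken)
      then show "colourable {v \<in> W. f v = i} ?E (8 * (2 ^ (\<kappa> + 2))\<^sup>2)"
        by (simp add: T_def)
    qed
    \<comment> \<open>For \<open>2 ^ \<kappa>\<close> above \<open>r\<close> the quotient is 0.
      Otherwise it absorbs one of the two factors \<open>2 ^ \<kappa>\<close>, and \<open>r\<close>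
      bounds the other.\<close>
    moreover have "r div 2 ^ \<kappa> * (8 * (2 ^ (\<kappa> + 2))\<^sup>2) \<le> 128 * r\<^sup>2"
    proof (cases "2 ^ \<kappa> \<le> r")
      case True
      have "r div 2 ^ \<kappa> * (8 * (2 ^ (\<kappa> + 2))\<^sup>2) = 128 * ((r div 2 ^ \<kappa> * 2 ^ \<kappa>) * 2 ^ \<kappa>)"
        by (simp add: power2_eq_square)
      also have "\<dots> \<le> 128 * (r * r)"
        using True by (intro mult_le_mono) auto
      finally show ?thesis
        by (simp add: power2_eq_square)
    qed simp
    ultimately have "colourable W ?E (128 * r\<^sup>2)"
      by (rule colourable_mono)
    then show "colourable {v \<in> V. k v = \<kappa>} ?E (128 * r\<^sup>2)"
      by (simp add: W_def)
  qed
qed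

section \<open>Reduction to a common dimension\<close>

text \<open>The factor \<open>2 * r\<close> bounds a set \<open>D\<close> of dimensions meeting
  every \<open>S v\<close>. Assigning each vertex to one of its dimensions in \<open>D\<close>
  leaves labelled intervals.\<close>

lemma colourable_two_dimensions:
  fixes S :: "'a \<Rightarrow> 'b set" and a b :: "'b \<Rightarrow> 'a \<Rightarrow> real"
  assumes fin: "finite V"
    and S: "\<And>v. v \<in> V \<Longrightarrow> card (S v) = 2"
    and ab: "\<And>i v. a i v \<le> b i v"
    and cl: "\<And>Q. Q \<subseteq> V \<Longrightarrow>
        pairwise (\<lambda>u v. \<forall>i\<in>S u \<inter> S v. overlap (a i) (b i) u v) Q \<Longrightarrow> card Q \<le> r"
    and K: "r < 2 ^ K"
  shows "colourable V (\<lambda>u v. \<forall>i\<in>S u \<inter> S v. overlap (a i) (b i) u v) (2 * r * (K * (128 * r\<^sup>2)))"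
proof -
  let ?E = "\<lambda>u v. \<forall>i\<in>S u \<inter> S v. overlap (a i) (b i) u v"
  define \<M> where "\<M> = {M. M \<subseteq> V \<and> pairwise (\<lambda>u v. S u \<inter> S v = {}) M}"
  have "finite \<M>"
    by (rule finite_subset[of _ "Pow V"]) (use fin in \<open>auto simp: \<M>_def\<close>)
  moreover have "{} \<in> \<M>"
    by (simp add: \<M>_def)
  ultimately obtain M where M: "M \<in> \<M>" and max: "\<And>M'. M' \<in> \<M> \<Longrightarrow> M \<subseteq> M' \<Longrightarrow> M = M'"
    using finite_has_maximal2 by metis
  have finM: "finite M"
    using M fin by (auto simp: \<M>_def intro: finite_subset)
  define D where "D = (\<Union>v\<in>M. S v)"
  have finS: "finite (S v)" if "v \<in> V" for v
    using S[OF that] by (metis card.infinite zero_neq_numeral)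
  have finD: "finite D"
    using M finM finS by (auto simp: D_def \<M>_def)
  \<comment> \<open>For disjoint sets \<open>S u\<close> and \<open>S v\<close> adjacency holds
    vacuously, so \<open>M\<close> is a clique.\<close>
  have "card M \<le> r"
    by (rule cl) (use M in \<open>auto simp: \<M>_def pairwise_def\<close>)
  moreover have "card D \<le> (\<Sum>v\<in>M. card (S v))"
    unfolding D_def by (rule card_UN_le[OF finM])
  moreover have "(\<Sum>v\<in>M. card (S v)) = (\<Sum>v\<in>M. 2)"
    using M S by (intro sum.cong) (auto simp: \<M>_def)
  ultimately have cardD: "card D \<le> 2 * r"
    by simp
  \<comment> \<open>Otherwise \<open>v\<close> could be added to \<open>M\<close>; maximality puts
    \<open>v\<close> in \<open>M\<close>, so \<open>S v\<close> is disjoint from itself and hence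
    empty.\<close>
  have "\<forall>v\<in>V. \<exists>i. i \<in> S v \<inter> D"
  proof (rule ballI, rule ccontr)
    fix v assume v: "v \<in> V" "\<nexists>i. i \<in> S v \<inter> D"
    then have disj: "S v \<inter> S u = {}" "S u \<inter> S v = {}" if "u \<in> M" for u
      using that by (auto simp: D_def)
    then have "insert v M \<in> \<M>"
      using M v(1) by (auto simp: \<M>_def pairwise_insert)
    then have "v \<in> M"
      using max by blast
    then have "S v = {}"
      using disj by blast
    then show False
      using S[OF v(1)] by simp
  qed
  from bchoice[OF this] obtain g where g: "\<And>v. v \<in> V \<Longrightarrow> g v \<in> S v \<inter> D"
    by blast
  have "\<forall>v\<in>V. \<exists>j. S v = {g v, j} \<and> j \<noteq> g v"
  proof
    fix v assume v: "v \<in> V"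
    from S[OF v] obtain p q where "S v = {p, q}" "p \<noteq> q"
      by (auto simp: card_2_iff)
    then show "\<exists>j. S v = {g v, j} \<and> j \<noteq> g v"
      using g[OF v] by auto
  qed
  from bchoice[OF this] obtain l where l: "\<And>v. v \<in> V \<Longrightarrow> S v = {g v, l v} \<and> l v \<noteq> g v"
    by blast
  obtain e where e: "bij_betw e D {0..<card D}"
    using ex_bij_betw_finite_nat[OF finD] by blast
  have "e (g v) < 2 * r" if "v \<in> V" for v
    using bij_betwE[OF e] g[OF that] cardD by fastforce
  then have "(\<lambda>v. e (g v)) ` V \<subseteq> {..<2 * r}"
    by auto
  then show ?thesis
  proof (rule colourable_partition)
    fix n
    define T where "T = {v \<in> V. e (g v) = n}"
    have "colourable T ?E (K * (128 * r\<^sup>2))"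
    proof (cases "T = {}")
      case True
      then show ?thesis by (simp add: colourable_def)
    next
      case False
      then obtain t where t: "t \<in> T" by blast
      define i where "i = g t"
      have gi: "g v = i" if "v \<in> T" for v
        using that t g e unfolding i_def T_def bij_betw_def by (auto dest: inj_onD)
      let ?E' = "\<lambda>u v. overlap (a i) (b i) u v \<and>
        (l u = l v \<longrightarrow> overlap (\<lambda>v. a (l v) v) (\<lambda>v. b (l v) v) u v)"
      \<comment> \<open>As \<open>S u = {i, l u}\<close> and \<open>S v = {i, l v}\<close>, the
        common dimensions are \<open>i\<close> and, when the labels agree, that label.\<close>
      have eq: "?E u v \<longleftrightarrow> ?E' u v" if "u \<in> T" "v \<in> T" for u v
        using l[of u] l[of v] gi[OF that(1)] gi[OF that(2)] that
        by (auto simp: T_def overlap_def)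
      have "colourable T ?E' (K * (128 * r\<^sup>2))"
      proof (rule colourable_labelled_intervals[OF _ ab ab _ K])
        show "finite T"
          using fin by (simp add: T_def)
        fix Q assume Q: "Q \<subseteq> T" "pairwise ?E' Q"
        show "card Q \<le> r"
        proof (rule cl)
          show "Q \<subseteq> V"
            using Q(1) by (auto simp: T_def)
          show "pairwise ?E Q"
          proof (rule pairwiseI)
            fix u v assume "u \<in> Q" "v \<in> Q" "u \<noteq> v"
            then show "?E u v"
              using pairwiseD[OF Q(2)] Q(1) eq[of u v] by blast
          qed
        qed
      qed
      then show ?thesis
        by (rule colourable_weaken) (use eq in blast)
    qed
    then show "colourable {v \<in> V. e (g v) = n} ?E (K * (128 * r\<^sup>2))"
      by (simp add: T_def)
  qed
qed

section \<open>From local boxes to compact intervals\<close>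

text \<open>One witness point is fixed in each nonempty intersection, and \<open>J v\<close> is
  replaced by the hull of its finitely many witnesses, which lies in \<open>J v\<close> by
  convexity.\<close>

lemma intervals_to_compact:
  fixes J :: "'a \<Rightarrow> real set"
  assumes fin: "finite V"
    and J: "\<And>v. is_interval (J v)" "\<And>v. J v \<noteq> {}"
  shows "\<exists>a b. (\<forall>v. a v \<le> b v) \<and>
    (\<forall>u\<in>V. \<forall>v\<in>V. overlap a b u v \<longleftrightarrow> J u \<inter> J v \<noteq> {})"
proof -
  \<comment> \<open>The choice depends on the intersection alone and is therefore symmetric in
    \<open>u\<close> and \<open>v\<close>.\<close>
  define p where "p u v = (SOME t. t \<in> J u \<inter> J v)" for u v
  have p: "p u v \<in> J u \<inter> J v" if "J u \<inter> J v \<noteq> {}" for u v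
    unfolding p_def by (rule someI_ex) (use that in blast)
  have p_sym: "p u v = p v u" for u v
    by (simp add: p_def Int_commute)
  \<comment> \<open>Inserting \<open>v\<close> keeps \<open>P v\<close> nonempty also for
    \<open>v\<close> outside \<open>V\<close>.\<close>
  define P where "P v = (\<lambda>u. p u v) ` {u \<in> insert v V. J u \<inter> J v \<noteq> {}}" for v
  have P: "finite (P v)" "P v \<noteq> {}" "P v \<subseteq> J v" for v
    using fin J(2)[of v] p by (auto simp: P_def)
  define a where "a v = Min (P v)" for v
  define b where "b v = Max (P v)" for v
  have mem: "a v \<le> t" "t \<le> b v" if "t \<in> P v" for t v
    using that P by (auto simp: a_def b_def)
  have ab: "a v \<le> b v" for v
    using mem[of _ v] P(2)[of v] by fastforce
  have abJ: "t \<in> J v" if "a v \<le> t" "t \<le> b v" for t v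
  proof -
    have "a v \<in> J v" "b v \<in> J v"
      using P(3)[of v] Min_in[OF P(1,2)] Max_in[OF P(1,2)] unfolding a_def b_def by blast+
    then show ?thesis
      using mem_is_interval_1_I[OF J(1)] that by blast
  qed
  have "overlap a b u v \<longleftrightarrow> J u \<inter> J v \<noteq> {}" if uv: "u \<in> V" "v \<in> V" for u v
  proof
    assume "overlap a b u v"
    then have "max (a u) (a v) \<in> J u \<inter> J v"
      using abJ ab[of u] ab[of v] by (auto simp: overlap_def)
    then show "J u \<inter> J v \<noteq> {}" by blast
  next
    assume ne: "J u \<inter> J v \<noteq> {}"
    then have "p u v \<in> P v" "p v u \<in> P u"
      using uv by (auto simp: P_def Int_commute)
    then show "overlap a b u v"
      using mem[of "p u v" v] mem[of "p u v" u] p_sym[of u v] by (auto simp: overlap_def)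
  qed
  then show ?thesis
    using ab by blast
qed

theorem theorem1p7:
  fixes G :: "'a pair_pre_digraph" and r :: nat
  assumes "pair_graph G"
    and "local_boxicity G \<le> 2"
    and "r = clique_number G"
  shows "real (chromatic_number G) \<le> 320 * real r ^ 3 * log 2 (2 * real r)"
proof -
  interpret pair_graph G by fact
  define V where "V = pverts G"
  have fin: "finite V"
    by (simp add: V_def)
  obtain d' B where rep: "local_box_representation G (local_boxicity G) d' B"
    using local_boxicity_attained[OF assms(1)] by blast
  have "\<forall>v\<in>V. \<exists>I. (\<forall>i<d'. real_interval (I i)) \<and> B v = Pi\<^sub>E {..<d'} I \<and>
      card {i. i < d' \<and> bounded (I i)} \<le> 2"
    using rep assms(2) unfolding local_box_representation_def local_box_def V_def
    by (meson order_trans)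
  from bchoice[OF this] obtain I where I: "\<And>v. v \<in> V \<Longrightarrow> (\<forall>i<d'. real_interval (I v i)) \<and>
      B v = Pi\<^sub>E {..<d'} (I v) \<and> card {i. i < d' \<and> bounded (I v i)} \<le> 2"
    by blast
  \<comment> \<open>The default \<open>UNIV\<close> makes dimensions from \<open>d'\<close> on
    harmless; \<open>S v\<close> below may contain such dimensions.\<close>
  define J where "J i v = (if v \<in> V \<and> i < d' then I v i else UNIV)" for i v
  have J: "is_interval (J i v)" "J i v \<noteq> {}" "bounded (J i v) \<or> J i v = UNIV" for i v
    using I by (auto simp: J_def real_interval_def)
  have "\<forall>i. \<exists>ab. (\<forall>v. fst ab v \<le> snd ab v) \<and>
      (\<forall>u\<in>V. \<forall>v\<in>V. overlap (fst ab) (snd ab) u v \<longleftrightarrow> J i u \<inter> J i v \<noteq> {})"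
    using intervals_to_compact[OF fin J(1) J(2)] by simp
  from choice[OF this] obtain ab where
    ab: "\<And>i v. fst (ab i) v \<le> snd (ab i) v"
      "\<And>i u v. u \<in> V \<Longrightarrow> v \<in> V \<Longrightarrow> overlap (fst (ab i)) (snd (ab i)) u v \<longleftrightarrow> J i u \<inter> J i v \<noteq> {}"
    by blast
  have "\<forall>v\<in>V. \<exists>S. {i. i < d' \<and> bounded (I v i)} \<subseteq> S \<and> card S = 2"
  proof
    fix v assume v: "v \<in> V"
    let ?A = "{i. i < d' \<and> bounded (I v i)}"
    \<comment> \<open>The bounded dimensions are padded to exactly two, if necessary by 0 or 1.
      Every added dimension has factor \<open>UNIV\<close>.\<close>
    have "card {..<2 :: nat} \<le> card (?A \<union> {..<2})"
      by (rule card_mono) auto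
    then show "\<exists>S. ?A \<subseteq> S \<and> card S = 2"
      using exists_subset_between[of ?A 2 "?A \<union> {..<2}"] I[OF v] by auto
  qed
  from bchoice[OF this] obtain S where
    S: "\<And>v. v \<in> V \<Longrightarrow> {i. i < d' \<and> bounded (I v i)} \<subseteq> S v \<and> card (S v) = 2"
    by blast
  let ?E = "\<lambda>u v. \<forall>i\<in>S u \<inter> S v. overlap (fst (ab i)) (snd (ab i)) u v"
  have E: "(u, v) \<in> parcs G \<longleftrightarrow> ?E u v" if uv: "u \<in> V" "v \<in> V" "u \<noteq> v" for u v
  proof -
    have "(u, v) \<in> parcs G \<longleftrightarrow> B u \<inter> B v \<noteq> {}"
      using rep uv by (auto simp: local_box_representation_def V_def)
    also have "\<dots> \<longleftrightarrow> (\<forall>i<d'. I u i \<inter> I v i \<noteq> {})"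
      using I[OF uv(1)] I[OF uv(2)] by (auto simp: PiE_Int PiE_eq_empty_iff)
    also have "\<dots> \<longleftrightarrow> (\<forall>i. J i u \<inter> J i v \<noteq> {})"
      using uv by (auto simp: J_def)
    also have "\<dots> \<longleftrightarrow> (\<forall>i\<in>S u \<inter> S v. J i u \<inter> J i v \<noteq> {})"
    proof -
      \<comment> \<open>Outside \<open>S u \<inter> S v\<close> one factor is \<open>UNIV\<close>
        and the other is nonempty.\<close>
      have "J i u \<inter> J i v \<noteq> {}" if "i \<notin> S u \<inter> S v" for i
      proof -
        have "J i u = UNIV \<or> J i v = UNIV"
          using that S[OF uv(1)] S[OF uv(2)] J(3)[of i u] J(3)[of i v] by (auto simp: J_def)
        then show ?thesis
          using J(2)[of i u] J(2)[of i v] by auto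
      qed
      then show ?thesis by blast
    qed
    also have "\<dots> \<longleftrightarrow> ?E u v"
      using ab(2) uv by simp
    finally show ?thesis .
  qed
  \<comment> \<open>For positive \<open>r\<close>, \<open>K\<close> is the number of binary digits
    of \<open>r\<close>. For \<open>r = 0\<close> no logarithmic bound is claimed, and the count of
    colours is 0.\<close>
  have "\<exists>K. r < 2 ^ K \<and> (1 \<le> r \<longrightarrow> real K \<le> log 2 (2 * real r))"
  proof (cases "1 \<le> r")
    case True
    then obtain n where n: "2 ^ n \<le> r" "r < 2 ^ (n + 1)"
      using ex_power_ivl1[of 2 r] by auto
    have "real n = log 2 (2 ^ n)"
      by simp
    also have "\<dots> \<le> log 2 (real r)"
      using n(1) True by (subst log_le_cancel_iff) (auto simp flip: of_nat_power simp: of_nat_le_iff)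
    finally have "real (n + 1) \<le> log 2 (2 * real r)"
      using True by (simp add: log_mult)
    then show ?thesis
      using n(2) by blast
  next
    case False
    then show ?thesis
      by (intro exI[of _ 0]) auto
  qed
  then obtain K where K: "r < 2 ^ K" "1 \<le> r \<Longrightarrow> real K \<le> log 2 (2 * real r)"
    by blast
  have "colourable V ?E (2 * r * (K * (128 * r\<^sup>2)))"
  proof (rule colourable_two_dimensions[OF fin _ ab(1) _ K(1)])
    show "card (S v) = 2" if "v \<in> V" for v
      using S[OF that] by blast
    show "card Q \<le> r" if Q: "Q \<subseteq> V" "pairwise ?E Q" for Q
    proof -
      have "clique G Q"
        using Q E unfolding clique_def pairwise_def V_def by blast
      then show ?thesis
        using clique_number_attained(2)[OF assms(1)] assms(3) by blast
    qed
  qed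
  then obtain c :: "'a \<Rightarrow> nat" where c: "c ` V \<subseteq> {..<2 * r * (K * (128 * r\<^sup>2))}"
      "pairwise (\<lambda>u v. ?E u v \<longrightarrow> c u \<noteq> c v) V"
    unfolding colourable_def by blast
  have "c u \<noteq> c v" if uv: "(u, v) \<in> parcs G" for u v
  proof -
    have "u \<in> V" "v \<in> V" "u \<noteq> v"
      using in_arcsD1[OF uv] in_arcsD2[OF uv] pair_no_loops[OF uv] by (auto simp: V_def)
    then show ?thesis
      using pairwiseD[OF c(2)] E uv by blast
  qed
  then have "proper_colouring G (2 * r * (K * (128 * r\<^sup>2))) c"
    using c(1) by (auto simp: proper_colouring_def V_def)
  then have "chromatic_number G \<le> 2 * r * (K * (128 * r\<^sup>2))"
    unfolding chromatic_number_def by (intro Least_le) blast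
  then have chi: "real (chromatic_number G) \<le> real (2 * r * (K * (128 * r\<^sup>2)))"
    by (simp only: of_nat_le_iff)
  show ?thesis
  proof (cases "1 \<le> r")
    case True
    have "real (2 * r * (K * (128 * r\<^sup>2))) = 256 * real r ^ 3 * real K"
      by (simp add: power2_eq_square power3_eq_cube)
    also have "\<dots> \<le> 320 * real r ^ 3 * log 2 (2 * real r)"
      using K(2)[OF True] by (intro mult_mono) auto
    finally show ?thesis
      using chi by linarith
  next
    case False
    then have "r = 0"
      by simp
    then show ?thesis
      using chi by simp
  qed
qed

end
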